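(* Let $n\ge 3$, $1\le t<n$, and let $c_1,c_2,\ldots,c_t\in[n]$ be distinct integers such that the sequence $(c_1,\ldots,c_t)$ avoids both patterns $213$ and $231$. If $(c_1,\ldots,c_t)$ is a shuffle of $(1,2,\ldots,t-s)$ and $(n,n-1,\ldots,n-s+1)$ for some $s\in\{0,1,\ldots,t\}$, then $$|S_{n,(c_1,\ldots,c_t)}(213,231)|=2^{n-t-1};$$ otherwise, $|S_{n,(c_1,\ldots,c_t)}(213,231)|=0$.
   Context: $[n]=\{1,\ldots,n\}$ and $S_n$ is the set of permutations of $[n]$ written as sequences $(\tau(1),\ldots,\tau(n))$. A sequence of distinct integers $\tau=(\tau(1),\ldots,\tau(m))$ contains $\sigma\in S_k$ as a pattern if there are indices $1\le i_1<\cdots<i_k\le m$ such that for all $1\le a<b\le k$, $\tau(i_a)<\tau(i_b)$ if and only if $\sigma(a)<\sigma(b)$; otherwise $\tau$ avoids $\sigma$. $S_{n,(c_1,\ldots,c_t)}(\sigma_1,\ldots,\sigma_m)$ is the set of $\tau\in S_n$ with $(\tau(1),\ldots,\tau(t))=(c_1,\ldots,c_t)$ that avoid all of $\sigma_1,\ldots,\sigma_m$. If $\sigma$ and $\tau$ are arrangements (permutations) of disjoint finite sets $A$ and $B$, a shuffle of $\sigma$ and $\tau$ is an arrangement of $A\cup B$ in which the elements of $A$ appear in the order given by $\sigma$ and the elements of $B$ appear in the order given by $\tau$. When $s=0$ the condition means $(c_1,\ldots,c_t)=(1,2,\ldots,t)$; when $s=t$ it means $(c_1,\ldots,c_t)=(n,n-1,\ldots,n-t+1)$.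 *)

theory Defs
  imports Main "HOL-Combinatorics.Multiset_Permutations"
begin

text \<open>
  Sequences are lists; the entry written $\tau(i)$ with $1 \le i \le m$ is \<open>\<tau> ! (i - 1)\<close>.
  Only the values of a pattern \<open>\<sigma>\<close> and of a permutation start at 1; positions start at 0.
\<close>

definition contains_pattern :: "'a::linorder list \<Rightarrow> nat list \<Rightarrow> bool" where
  "contains_pattern \<tau> \<sigma> \<longleftrightarrow>
     (\<exists>i :: nat \<Rightarrow> nat.
        strict_mono_on {..<length \<sigma>} i \<and>
        i ` {..<length \<sigma>} \<subseteq> {..<length \<tau>} \<and>
        (\<forall>a b. a < b \<and> b < length \<sigma> \<longrightarrow>
           (\<tau> ! i a < \<tau> ! i b \<longleftrightarrow> \<sigma> ! a < \<sigma> ! b)))"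

definition avoids_pattern :: "'a::linorder list \<Rightarrow> nat list \<Rightarrow> bool" where
  "avoids_pattern \<tau> \<sigma> \<longleftrightarrow> \<not> contains_pattern \<tau> \<sigma>"

definition avoiding_perms :: "nat \<Rightarrow> nat list \<Rightarrow> nat list set \<Rightarrow> nat list set" where
  "avoiding_perms n c \<Sigma> =
     {\<tau> \<in> permutations_of_set {1..n}.
        take (length c) \<tau> = c \<and> (\<forall>\<sigma>\<in>\<Sigma>. avoids_pattern \<tau> \<sigma>)}"

end

theory Submission
  imports Defs
begin

text \<open>
  A sequence of distinct numbers avoids 213 and 231 iff each of its entries is the minimum or the
  maximum of the entries from that position on. So an avoiding permutation of an interval is built
  by repeatedly removing an endpoint: before the last step there are two choices each time, and
  the prefixes that arise in this way are exactly the shuffles of an increasing run from the lower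
  end with a decreasing run from the upper end.
\<close>

section \<open>Avoidance of 213 and 231 as a condition on suffixes\<close>

fun suffix_extremal :: "'a::linorder list \<Rightarrow> bool" where
  "suffix_extremal [] \<longleftrightarrow> True"
| "suffix_extremal (x # xs) \<longleftrightarrow>
     ((\<forall>y\<in>set xs. x < y) \<or> (\<forall>y\<in>set xs. y < x)) \<and> suffix_extremal xs"

text \<open>Trades the index function for three explicit positions, the form in which occurrences of
  213 and 231 are compared below.\<close>

lemma contains_pattern_length3_iff:
  "contains_pattern xs [p, q, r] \<longleftrightarrow>
     (\<exists>i j k. i < j \<and> j < k \<and> k < length xs \<and>
        (xs ! i < xs ! j \<longleftrightarrow> p < q) \<and> (xs ! i < xs ! k \<longleftrightarrow> p < r) \<and> (xs ! j < xs ! k \<longleftrightarrow> q < r))"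
  (is "?L \<longleftrightarrow> ?R")
proof
  assume ?L
  then obtain f :: "nat \<Rightarrow> nat" where f: "strict_mono_on {..<3} f" "f ` {..<3} \<subseteq> {..<length xs}"
    "\<And>a b. a < b \<Longrightarrow> b < 3 \<Longrightarrow> xs ! f a < xs ! f b \<longleftrightarrow> [p, q, r] ! a < [p, q, r] ! b"
    unfolding contains_pattern_def by (auto simp: numeral_3_eq_3)
  have "f 0 < f 1" "f 1 < f 2" using f(1) by (auto simp: strict_mono_on_def)
  moreover have "f 2 < length xs" using f(2) by (simp add: image_subset_iff)
  ultimately show ?R using f(3)[of 0 1] f(3)[of 0 2] f(3)[of 1 2]
    by (intro exI[of _ "f 0"] exI[of _ "f 1"] exI[of _ "f 2"]) auto
next
  assume ?R
  then obtain i j k where ijk: "i < j" "j < k" "k < length xs"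
    "xs ! i < xs ! j \<longleftrightarrow> p < q" "xs ! i < xs ! k \<longleftrightarrow> p < r" "xs ! j < xs ! k \<longleftrightarrow> q < r"
    by blast
  define f where "f = (\<lambda>m::nat. [i, j, k] ! m)"
  have less3: "m < 3 \<longleftrightarrow> m = 0 \<or> m = 1 \<or> m = 2" for m :: nat by auto
  have "strict_mono_on {..<3} f"
    using ijk by (auto simp: strict_mono_on_def f_def less3)
  moreover have "f ` {..<3} \<subseteq> {..<length xs}"
    using ijk by (auto simp: f_def less3)
  moreover have "xs ! f a < xs ! f b \<longleftrightarrow> [p, q, r] ! a < [p, q, r] ! b" if "a < b" "b < 3" for a b
  proof -
    have "a = 0 \<and> b = 1 \<or> a = 0 \<and> b = 2 \<or> a = 1 \<and> b = 2" using that by auto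
    then show ?thesis using ijk by (auto simp: f_def)
  qed
  ultimately show ?L
    unfolding contains_pattern_def by (intro exI[of _ f]) (simp add: numeral_3_eq_3)
qed

lemma all_nat_iff: "(\<forall>n. P n) \<longleftrightarrow> P 0 \<and> (\<forall>n. P (Suc n))" for P :: "nat \<Rightarrow> bool"
  using nat.exhaust by metis

text \<open>The order of \<open>j\<close> and \<open>k\<close> is left open, so one condition covers
  both patterns: \<open>j < k\<close> is an occurrence of 213 and \<open>k < j\<close> one of
  231.\<close>

lemma suffix_extremal_iff_nth:
  assumes "distinct xs"
  shows "suffix_extremal xs \<longleftrightarrow>
    (\<forall>i j k. i < j \<and> i < k \<and> j < length xs \<and> k < length xs \<longrightarrow> \<not> (xs ! j < xs ! i \<and> xs ! i < xs ! k))"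
  using assms
proof (induction xs)
  case (Cons x xs)
  let ?Q = "\<lambda>xs i. \<forall>j k. i < j \<and> i < k \<and> j < length xs \<and> k < length xs \<longrightarrow>
    \<not> (xs ! j < xs ! i \<and> xs ! i < xs ! k)"
  have split: "(\<forall>i. ?Q (x # xs) i) \<longleftrightarrow> ?Q (x # xs) 0 \<and> (\<forall>i. ?Q (x # xs) (Suc i))"
    by (rule all_nat_iff)
  \<comment> \<open>Position 0 is not above \<open>Suc i\<close>, so \<open>j\<close> and
    \<open>k\<close> are successors, that is, positions in the tail.\<close>
  have "?Q (x # xs) (Suc i) \<longleftrightarrow> ?Q xs i" for i
    by (subst (1 2) all_nat_iff) auto
  moreover have "?Q (x # xs) 0 \<longleftrightarrow> (\<forall>y\<in>set xs. \<forall>z\<in>set xs. \<not> (y < x \<and> x < z))"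
    by (subst (1 2) all_nat_iff) (simp, metis in_set_conv_nth)
  moreover have "\<dots> \<longleftrightarrow> (\<forall>y\<in>set xs. x < y) \<or> (\<forall>y\<in>set xs. y < x)"
  proof -
    \<comment> \<open>Distinctness excludes \<open>y = x\<close>; hence having no entries on both
      sides of \<open>x\<close> means that all lie on one side.\<close>
    have "y < x \<or> x < y" if "y \<in> set xs" for y
      using that Cons.prems by (metis distinct.simps(2) linorder_neqE)
    then show ?thesis by (metis order.asym)
  qed
  ultimately show ?case using split Cons by simp
qed simp

lemma avoids_213_231_iff:
  assumes "distinct xs"
  shows "avoids_pattern xs [2, 1, 3] \<and> avoids_pattern xs [2, 3, 1] \<longleftrightarrow> suffix_extremal xs"
proof
  assume av: "avoids_pattern xs [2, 1, 3] \<and> avoids_pattern xs [2, 3, 1]"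
  show "suffix_extremal xs"
    unfolding suffix_extremal_iff_nth[OF assms]
  proof (intro allI impI notI)
    fix i j k
    assume *: "i < j \<and> i < k \<and> j < length xs \<and> k < length xs" "xs ! j < xs ! i \<and> xs ! i < xs ! k"
    then consider "j < k" | "k < j" by fastforce
    then show False
    proof cases
      case 1
      then have "contains_pattern xs [2, 1, 3]"
        unfolding contains_pattern_length3_iff using *
        by (intro exI[of _ i] exI[of _ j] exI[of _ k]) auto
      then show False using av by (simp add: avoids_pattern_def)
    next
      case 2
      then have "contains_pattern xs [2, 3, 1]"
        unfolding contains_pattern_length3_iff using *
        by (intro exI[of _ i] exI[of _ k] exI[of _ j]) auto
      then show False using av by (simp add: avoids_pattern_def)
    qed
  qed
next
  assume "suffix_extremal xs"
  then have se: "\<not> (xs ! j < xs ! i \<and> xs ! i < xs ! k)"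
    if "i < j" "i < k" "j < length xs" "k < length xs" for i j k
    using that suffix_extremal_iff_nth[OF assms] by blast
  \<comment> \<open>Patterns are compared through \<open><\<close> alone, so a descent appears only
    as a negated \<open><\<close>; distinctness makes it strict.\<close>
  have ne: "xs ! i \<noteq> xs ! j" if "i < j" "j < length xs" for i j
    using that assms by (simp add: nth_eq_iff_index_eq)
  have "\<not> contains_pattern xs [2, 1, 3]"
  proof
    assume "contains_pattern xs [2, 1, 3]"
    then obtain i j k where "i < j" "j < k" "k < length xs" "\<not> xs ! i < xs ! j" "xs ! i < xs ! k"
      unfolding contains_pattern_length3_iff by auto
    with se[of i j k] ne[of i j] show False by auto
  qed
  moreover have "\<not> contains_pattern xs [2, 3, 1]"
  proof
    assume "contains_pattern xs [2, 3, 1]"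
    then obtain i j k where "i < j" "j < k" "k < length xs" "xs ! i < xs ! j" "\<not> xs ! i < xs ! k"
      unfolding contains_pattern_length3_iff by auto
    with se[of i k j] ne[of i k] show False by auto
  qed
  ultimately show "avoids_pattern xs [2, 1, 3] \<and> avoids_pattern xs [2, 3, 1]"
    by (simp add: avoids_pattern_def)
qed

section \<open>Counting extremal arrangements of an interval\<close>

text \<open>Both endpoints are parameters because removing the minimum or maximum of an interval
  leaves an interval again.\<close>

definition extremal_perms :: "nat \<Rightarrow> nat \<Rightarrow> nat list set" where
  "extremal_perms a b = {xs \<in> permutations_of_set {a..<b}. suffix_extremal xs}"

lemma finite_extremal_perms [simp]: "finite (extremal_perms a b)"
  by (simp add: extremal_perms_def)

lemma Cons_in_extremal_perms_iff:
  assumes "a < b"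
  shows "x # xs \<in> extremal_perms a b \<longleftrightarrow>
    x = a \<and> xs \<in> extremal_perms (Suc a) b \<or> x = b - 1 \<and> xs \<in> extremal_perms a (b - 1)"
proof -
  \<comment> \<open>The choice of the first entry depends only on the set \<open>S\<close> of the
    remaining values. With \<open>S = set xs\<close>, the conditions on the tail itself carry over
    unchanged.\<close>
  have "insert x S = {a..<b} \<and> x \<notin> S \<and> ((\<forall>y\<in>S. x < y) \<or> (\<forall>y\<in>S. y < x)) \<longleftrightarrow>
      x = a \<and> S = {Suc a..<b} \<or> x = b - 1 \<and> S = {a..<b - 1}" (is "?L \<longleftrightarrow> ?R") for S
  proof
    assume L: ?L
    then have S: "S = {a..<b} - {x}" and x: "a \<le> x" "x < b" by auto
    have "x = a" if "\<forall>y\<in>S. x < y"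
      using that x assms S by (metis DiffI atLeastLessThan_iff insertE empty_iff le_refl leD)
    moreover have "x = b - 1" if "\<forall>y\<in>S. y < x"
    proof (rule ccontr)
      assume "x \<noteq> b - 1"
      then have "b - 1 \<in> S" using S assms by auto
      then show False using that x by fastforce
    qed
    moreover have "{a..<b} - {a} = {Suc a..<b}" "{a..<b} - {b - 1} = {a..<b - 1}" by auto
    ultimately show ?R using L unfolding S by metis
  next
    assume ?R
    then show ?L using assms by (elim disjE) auto
  qed
  from this[of "set xs"] show ?thesis
    unfolding extremal_perms_def permutations_of_set_def mem_Collect_eq list.set distinct.simps
      suffix_extremal.simps by argo
qed

text \<open>Removing either endpoint leaves an interval one shorter, and the two families have
  different heads, so the count doubles. For a single element the endpoints coincide, which accounts
  for the \<open>- 1\<close> in the exponent.\<close>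

lemma card_extremal_perms:
  assumes "a < b"
  shows "card (extremal_perms a b) = 2 ^ (b - a - 1)"
  using assms
proof (induction "b - a" arbitrary: a b)
  case (Suc m)
  show ?case
  proof (cases "b = Suc a")
    case True
    then have "permutations_of_set {a..<b} = {[a]}" by simp
    then have "extremal_perms a b = {[a]}"
      unfolding extremal_perms_def by force
    then show ?thesis using True by simp
  next
    case False
    with Suc.prems have ab: "Suc a < b" by simp
    have "[] \<notin> extremal_perms a b"
      using ab by (auto simp: extremal_perms_def permutations_of_set_def)
    then have "extremal_perms a b =
        (#) a ` extremal_perms (Suc a) b \<union> (#) (b - 1) ` extremal_perms a (b - 1)"
      using Cons_in_extremal_perms_iff[of a b] ab
      by (intro set_eqI) (rename_tac xs, case_tac xs, auto)
    moreover have "(#) a ` extremal_perms (Suc a) b \<inter> (#) (b - 1) ` extremal_perms a (b - 1) = {}"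
      using ab by auto
    ultimately have "card (extremal_perms a b) =
        card (extremal_perms (Suc a) b) + card (extremal_perms a (b - 1))"
      by (simp add: card_Un_disjoint card_image)
    also have "\<dots> = 2 ^ (b - a - 2) + 2 ^ (b - a - 2)"
      using Suc.hyps(1)[of b "Suc a"] Suc.hyps(1)[of "b - 1" a] Suc.hyps(2) ab
      by (simp add: numeral_2_eq_2)
    also have "\<dots> = 2 ^ (b - a - 1)"
      using ab by (simp flip: mult_2 power_Suc add: Suc_diff_Suc numeral_2_eq_2)
    finally show ?thesis .
  qed
qed simp

section \<open>Prefixes as shuffles of two runs from the ends\<close>

text \<open>The shuffle condition of the theorem for a general interval \<open>{a..<b}\<close>.
  Quantifying over both run lengths avoids a truncated subtraction in the induction.\<close>

definition outer_shuffle :: "nat \<Rightarrow> nat \<Rightarrow> nat list \<Rightarrow> bool" where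
  "outer_shuffle a b c \<longleftrightarrow>
     (\<exists>p s. p + s = length c \<and> c \<in> shuffles [a..<a + p] (rev [b - s..<b]))"

text \<open>The head of a shuffle is the head of one of the two runs, and dropping it leaves a
  shuffle for the interval without that endpoint. This is the same recursion as in
  \<open>Cons_in_extremal_perms_iff\<close>.\<close>

lemma outer_shuffle_Cons_iff:
  assumes "Suc (length c) \<le> b - a"
  shows "outer_shuffle a b (x # c) \<longleftrightarrow>
    x = a \<and> outer_shuffle (Suc a) b c \<or> x = b - 1 \<and> outer_shuffle a (b - 1) c"
    (is "?L \<longleftrightarrow> ?A \<or> ?B")
proof -
  have up: "[a..<a + Suc p] = a # [Suc a..<Suc a + p]" for p
    by (simp add: upt_conv_Cons del: upt_Suc)
  \<comment> \<open>The length bound makes \<open>b\<close> positive; for \<open>b = 0\<close> the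
    left side would be empty.\<close>
  have down: "rev [b - Suc s..<b] = (b - 1) # rev [b - 1 - s..<b - 1]" for s
    using assms by (cases b) auto
  show ?thesis
  proof
    assume ?L
    then obtain p s where ps: "p + s = Suc (length c)"
      and sh: "x # c \<in> shuffles [a..<a + p] (rev [b - s..<b])"
      by (auto simp: outer_shuffle_def)
    from sh consider "[a..<a + p] \<noteq> []" "x = hd [a..<a + p]"
        "c \<in> shuffles (tl [a..<a + p]) (rev [b - s..<b])"
      | "rev [b - s..<b] \<noteq> []" "x = hd (rev [b - s..<b])"
        "c \<in> shuffles [a..<a + p] (tl (rev [b - s..<b]))"
      unfolding Cons_in_shuffles_iff by blast
    then show "?A \<or> ?B"
    proof cases
      case 1
      then obtain p' where "p = Suc p'" by (cases p) auto
      with 1 ps have "x = a" "p' + s = length c"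
        "c \<in> shuffles [Suc a..<Suc a + p'] (rev [b - s..<b])"
        by (simp_all only: up list.sel add_Suc nat.inject)
      then show ?thesis unfolding outer_shuffle_def by blast
    next
      case 2
      then obtain s' where "s = Suc s'" by (cases s) auto
      with 2 ps have "x = b - 1" "p + s' = length c"
        "c \<in> shuffles [a..<a + p] (rev [b - 1 - s'..<b - 1])"
        by (simp_all only: down list.sel add_Suc_right nat.inject)
      then show ?thesis unfolding outer_shuffle_def by blast
    qed
  next
    assume "?A \<or> ?B"
    then show ?L
    proof
      assume ?A
      then obtain p s where "p + s = length c" "x = a"
        "c \<in> shuffles [Suc a..<Suc a + p] (rev [b - s..<b])"
        by (auto simp: outer_shuffle_def)
      then show ?L unfolding outer_shuffle_def
        by (intro exI[of _ "Suc p"] exI[of _ s]) (simp add: up Cons_in_shuffles_iff del: upt_Suc)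
    next
      assume ?B
      then obtain p s where "p + s = length c" "x = b - 1"
        "c \<in> shuffles [a..<a + p] (rev [b - 1 - s..<b - 1])"
        by (auto simp: outer_shuffle_def)
      then show ?L unfolding outer_shuffle_def
        by (intro exI[of _ p] exI[of _ "Suc s"])
          (simp add: down Cons_in_shuffles_iff del: upt_Suc)
    qed
  qed
qed

text \<open>Each prescribed entry must be a current endpoint and shortens interval and prefix by
  one, so \<open>b - a - length c\<close> is invariant. Once the prefix is used up, the remaining
  interval is counted freely.\<close>

lemma card_extremal_perms_prefix:
  assumes "length c < b - a"
  shows "card {xs \<in> extremal_perms a b. take (length c) xs = c} =
    (if outer_shuffle a b c then 2 ^ (b - a - length c - 1) else 0)"
  using assms
proof (induction c arbitrary: a b)
  case Nil
  then show ?case by (simp add: card_extremal_perms outer_shuffle_def)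
next
  case (Cons x c)
  let ?P = "\<lambda>a b. {xs \<in> extremal_perms a b. take (length c) xs = c}"
  have "{xs \<in> extremal_perms a b. take (length (x # c)) xs = x # c} =
      (#) x ` ((if x = a then ?P (Suc a) b else {}) \<union> (if x = b - 1 then ?P a (b - 1) else {}))"
    using Cons_in_extremal_perms_iff[of a b] Cons.prems
    by (intro set_eqI) (rename_tac xs, case_tac xs, auto)
  then have card_eq: "card {xs \<in> extremal_perms a b. take (length (x # c)) xs = x # c} =
      card ((if x = a then ?P (Suc a) b else {}) \<union> (if x = b - 1 then ?P a (b - 1) else {}))"
    by (simp add: card_image)
  \<comment> \<open>At least two values remain, so \<open>x\<close> matches at most one endpoint and
    at most one set of the union contributes.\<close>
  have "a \<noteq> b - 1" using Cons.prems by auto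
  then consider "x = a" "x \<noteq> b - 1" | "x = b - 1" "x \<noteq> a" | "x \<noteq> a" "x \<noteq> b - 1" by blast
  then show ?case
    using card_eq Cons.IH[of b "Suc a"] Cons.IH[of "b - 1" a] Cons.prems
      outer_shuffle_Cons_iff[of c b a x]
    by cases (simp_all add: diff_right_commute)
qed

section \<open>The count for permutations of \<open>{1..n}\<close>\<close>

theorem theorem5p3:
  fixes n t :: nat and c :: "nat list"
  assumes "3 \<le> n" and "1 \<le> t" and "t < n"
    and "length c = t" and "distinct c" and "set c \<subseteq> {1..n}"
    and "avoids_pattern c [2, 1, 3]" and "avoids_pattern c [2, 3, 1]"
  shows
    "((\<exists>s\<in>{0..t}. c \<in> shuffles [1..<t - s + 1] (rev [n - s + 1..<n + 1])) \<longrightarrow>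
        card (avoiding_perms n c {[2, 1, 3], [2, 3, 1]}) = 2 ^ (n - t - 1)) \<and>
     (\<not> (\<exists>s\<in>{0..t}. c \<in> shuffles [1..<t - s + 1] (rev [n - s + 1..<n + 1])) \<longrightarrow>
        card (avoiding_perms n c {[2, 1, 3], [2, 3, 1]}) = 0)"
proof -
  have "avoiding_perms n c {[2, 1, 3], [2, 3, 1]} =
      {xs \<in> extremal_perms 1 (Suc n). take (length c) xs = c}"
    using avoids_213_231_iff
    by (auto simp: avoiding_perms_def extremal_perms_def permutations_of_set_def
        atLeastLessThanSuc_atLeastAtMost)
  moreover have "length c < Suc n - 1" using assms by simp
  ultimately have "card (avoiding_perms n c {[2, 1, 3], [2, 3, 1]}) =
      (if outer_shuffle 1 (Suc n) c then 2 ^ (n - t - 1) else 0)"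
    using card_extremal_perms_prefix[of c "Suc n" 1] assms by simp
  moreover have "outer_shuffle 1 (Suc n) c \<longleftrightarrow>
      (\<exists>s\<in>{0..t}. c \<in> shuffles [1..<t - s + 1] (rev [n - s + 1..<n + 1]))"
  proof -
    \<comment> \<open>The length of the increasing run is determined by \<open>s\<close>; the range
      \<open>{0..t}\<close> keeps \<open>t - s\<close> from being truncated.\<close>
    have "(\<exists>p s. p + s = t \<and> Q p s) \<longleftrightarrow> (\<exists>s\<in>{0..t}. Q (t - s) s)" for Q :: "nat \<Rightarrow> nat \<Rightarrow> bool"
      by (metis add_diff_cancel_right' atLeastAtMost_iff le_add2 le_add_diff_inverse2 zero_le)
    then have "outer_shuffle 1 (Suc n) c \<longleftrightarrow>
        (\<exists>s\<in>{0..t}. c \<in> shuffles [1..<1 + (t - s)] (rev [Suc n - s..<Suc n]))"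
      unfolding outer_shuffle_def assms(4) .
    also have "\<dots> \<longleftrightarrow> (\<exists>s\<in>{0..t}. c \<in> shuffles [1..<t - s + 1] (rev [n - s + 1..<n + 1]))"
      \<comment> \<open>From \<open>s \<le> t\<close> and \<open>t < n\<close> follows
        \<open>Suc n - s = n - s + 1\<close>.\<close>
      using assms(3) by (intro bex_cong refl) (simp add: Suc_diff_le del: upt_Suc)
    finally show ?thesis .
  qed
  ultimately show ?thesis by simp
qed

end
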